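(* Consider the Painlevé rod problem with $m_1,m_2,l,g>0$, described in the context. (1) Let $\lambda>0$ and $N=(0,\lambda)^T$. A non-negative-definite real $2\times2$ matrix $\Phi_c$ satisfies $\Phi_c^{T}QN=\rho N$ for some $\rho\in\mathbb{R}$, where $Q=PA^{-1}P^{T}$, if and only if it has the form $$\Phi_c=\begin{pmatrix}\varkappa_1&\varkappa_2\\[2pt] \dfrac{\varkappa_1m_2\sin2\theta}{2m_1+m_2(1+\cos2\theta)}&\mu_2\end{pmatrix},\qquad \Phi_c\ge0 .$$ (2) With this $\Phi_c$ and the generalized friction force $F=-\lambda\,P^{T}\Phi_cv_c/|v_c|$, the equations of motion under continuous contact ($y=\dot y=\ddot y=0$), namely $$(m_1+m_2)\ddot x-lm_2\ddot\theta\sin\theta=lm_2\dot\theta^2\cos\theta-\lambda\varkappa_1s,$$ $$lm_2(\ddot x\sin\theta-l\ddot\theta)=lm_2g\cos\theta,$$ $$lm_2\ddot\theta\cos\theta=-(m_1+m_2)g+lm_2\dot\theta^2\sin\theta+\lambda-\lambda s\,\frac{\varkappa_1m_2\sin2\theta}{2m_1+m_2(1+\cos2\theta)},$$ with $s\in\sigma(\dot x)$, imply that the Lagrange multiplier is the same as in the absence of friction: $$\lambda=\frac{2m_1\bigl((m_1+m_2)g-lm_2\dot\theta^2\sin\theta\bigr)}{2m_1+m_2(1+\cos2\theta)} .$$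
   Context: Two material points $M_1,M_2$ of masses $m_1,m_2$ are joined by a weightless rigid rod of length $l$. $(x,y)$ are the Cartesian coordinates of $M_1$, constrained by $y\ge0$; $\theta$ is the angle between $M_1M_2$ and the axis $Ox$; $g$ is the acceleration of gravity. The generalized coordinates are $(x,\theta,y)$, in this order. $\lambda$ is the Lagrange multiplier (normal support reaction) of the constraint $y\ge0$. The kinetic energy matrix, the map from generalized velocities to the velocity of the contact point, and that velocity are $$A=\begin{pmatrix}m_1+m_2&-lm_2\sin\theta&0\\-lm_2\sin\theta&m_2l^2&lm_2\cos\theta\\0&lm_2\cos\theta&m_1+m_2\end{pmatrix},\quad P=\begin{pmatrix}1&0&0\\0&0&1\end{pmatrix},\quad v_c=\begin{pmatrix}\dot x\\\dot y\end{pmatrix}.$$ The set-valued sign is $\sigma(u)=\{-1\}$ for $u<0$, $\sigma(0)=[-1,1]$, $\sigma(u)=\{1\}$ for $u>0$. A real square matrix $M$, not necessarily symmetric, is called non-negative-definite ($M\ge0$) if $(Mw,w)\ge0$ for all $w$. $\varkappa_1,\varkappa_2,\mu_2$ denote real friction coefficients. *)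

theory Defs
  imports "HOL-Analysis.Analysis"
begin

definition nonneg_definite :: "real^'n^'n \<Rightarrow> bool" where
  "nonneg_definite M \<longleftrightarrow> (\<forall>w. (M *v w) \<bullet> w \<ge> 0)"

definition set_sign :: "real \<Rightarrow> real set" where
  "set_sign u = (if u < 0 then {-1} else if u = 0 then {-1..1} else {1})"

text \<open>The generalized coordinates are ordered as $(x,\theta,y)$, so that for
  \<open>q :: real^3\<close> we have \<open>x = q $ 1\<close>, \<open>\<theta> = q $ 2\<close>, \<open>y = q $ 3\<close>.\<close>

definition rod_A :: "real \<Rightarrow> real \<Rightarrow> real \<Rightarrow> real \<Rightarrow> real^3^3" where
  "rod_A m1 m2 l \<theta> =
     vector [vector [m1 + m2, - l * m2 * sin \<theta>, 0],
             vector [- l * m2 * sin \<theta>, m2 * l^2, l * m2 * cos \<theta>],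
             vector [0, l * m2 * cos \<theta>, m1 + m2]]"

definition rod_P :: "real^3^2" where
  "rod_P = vector [vector [1, 0, 0], vector [0, 0, 1]]"

definition rod_Q :: "real \<Rightarrow> real \<Rightarrow> real \<Rightarrow> real \<Rightarrow> real^2^2" where
  "rod_Q m1 m2 l \<theta> = rod_P ** matrix_inv (rod_A m1 m2 l \<theta>) ** transpose rod_P"

definition normal_force :: "real \<Rightarrow> real^2" where
  "normal_force lam = vector [0, lam]"

definition friction_matrix ::
    "real \<Rightarrow> real \<Rightarrow> real \<Rightarrow> real \<Rightarrow> real \<Rightarrow> real \<Rightarrow> real^2^2" where
  "friction_matrix m1 m2 \<theta> \<kappa>1 \<kappa>2 \<mu>2 =
     vector [vector [\<kappa>1, \<kappa>2],
             vector [\<kappa>1 * m2 * sin (2 * \<theta>) / (2 * m1 + m2 * (1 + cos (2 * \<theta>))), \<mu>2]]"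

definition kinetic_energy :: "real \<Rightarrow> real \<Rightarrow> real \<Rightarrow> real^3 \<Rightarrow> real^3 \<Rightarrow> real" where
  "kinetic_energy m1 m2 l q v = ((rod_A m1 m2 l (q $ 2) *v v) \<bullet> v) / 2"

text \<open>The ordinates of the two points are \<open>y\<close> and \<open>y + l sin \<theta>\<close>.\<close>

definition potential_energy :: "real \<Rightarrow> real \<Rightarrow> real \<Rightarrow> real \<Rightarrow> real^3 \<Rightarrow> real" where
  "potential_energy m1 m2 l g q = m1 * g * q $ 3 + m2 * g * (q $ 3 + l * sin (q $ 2))"

definition partial_deriv :: "(real^'n \<Rightarrow> real) \<Rightarrow> 'n \<Rightarrow> real^'n \<Rightarrow> real" where
  "partial_deriv f i p = deriv (\<lambda>h. f (p + h *\<^sub>R axis i 1)) 0"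

text \<open>Lagrange's equations of the second kind at time \<open>t\<close>, along a motion \<open>q\<close> with
  velocity \<open>v\<close>, for the generalized non-potential force \<open>R\<close> acting at time \<open>t\<close>:
  $\frac{d}{dt}\,\partial T/\partial\dot q_i = \partial T/\partial q_i
    - \partial\Pi/\partial q_i + R_i$.\<close>

definition lagrange_equations ::
    "real \<Rightarrow> real \<Rightarrow> real \<Rightarrow> real \<Rightarrow> (real \<Rightarrow> real^3) \<Rightarrow> (real \<Rightarrow> real^3) \<Rightarrow> real^3 \<Rightarrow> real \<Rightarrow> bool" where
  "lagrange_equations m1 m2 l g q v R t \<longleftrightarrow>
     (\<forall>i. ((\<lambda>\<tau>. partial_deriv (kinetic_energy m1 m2 l (q \<tau>)) i (v \<tau>))
            has_real_derivative
              (partial_deriv (\<lambda>p. kinetic_energy m1 m2 l p (v t)) i (q t)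
               - partial_deriv (potential_energy m1 m2 l g) i (q t) + R $ i)) (at t))"

text \<open>The admissible values of $v_c/|v_c|$ under contact. The quotient is undefined at rest;
  as $v_c = (\dot x, 0)^T$ under contact, it is then replaced by all $(s,0)^T$ with
  $s\in\sigma(0)$.\<close>

definition sliding_directions :: "real^2 \<Rightarrow> (real^2) set" where
  "sliding_directions vc =
     (if vc = 0 then {vector [s, 0] |s. s \<in> set_sign 0} else {vc /\<^sub>R norm vc})"

definition friction_force :: "real \<Rightarrow> real^2^2 \<Rightarrow> real^2 \<Rightarrow> real^3" where
  "friction_force lam \<Phi> d = - lam *\<^sub>R (transpose rod_P *v (\<Phi> *v d))"

text \<open>In the next two definitions \<open>\<omega>\<close> is $\dot\theta$, \<open>ax\<close> is $\ddot x$ and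
  \<open>\<epsilon>\<close> is $\ddot\theta$.\<close>

definition contact_equations ::
    "real \<Rightarrow> real \<Rightarrow> real \<Rightarrow> real \<Rightarrow> real \<Rightarrow> real \<Rightarrow> real \<Rightarrow> real \<Rightarrow> real \<Rightarrow> real \<Rightarrow> real \<Rightarrow> bool" where
  "contact_equations m1 m2 l g \<kappa>1 s \<theta> \<omega> ax \<epsilon> lam \<longleftrightarrow>
     (m1 + m2) * ax - l * m2 * \<epsilon> * sin \<theta> = l * m2 * \<omega>^2 * cos \<theta> - lam * \<kappa>1 * s \<and>
     l * m2 * (ax * sin \<theta> - l * \<epsilon>) = l * m2 * g * cos \<theta> \<and>
     l * m2 * \<epsilon> * cos \<theta> =
       - (m1 + m2) * g + l * m2 * \<omega>^2 * sin \<theta> + lam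
       - lam * s * (\<kappa>1 * m2 * sin (2 * \<theta>) / (2 * m1 + m2 * (1 + cos (2 * \<theta>))))"

definition frictionless_contact_equations ::
    "real \<Rightarrow> real \<Rightarrow> real \<Rightarrow> real \<Rightarrow> real \<Rightarrow> real \<Rightarrow> real \<Rightarrow> real \<Rightarrow> real \<Rightarrow> bool" where
  "frictionless_contact_equations m1 m2 l g \<theta> \<omega> ax \<epsilon> lam \<longleftrightarrow>
     (m1 + m2) * ax - l * m2 * \<epsilon> * sin \<theta> = l * m2 * \<omega>^2 * cos \<theta> \<and>
     l * m2 * (ax * sin \<theta> - l * \<epsilon>) = l * m2 * g * cos \<theta> \<and>
     l * m2 * \<epsilon> * cos \<theta> = - (m1 + m2) * g + l * m2 * \<omega>^2 * sin \<theta> + lam"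

end

theory Submission
  imports Defs
begin

text \<open>
  For (1), only the vector \<open>A\<^sup>-\<^sup>1 P\<^sup>T N\<close> is needed, not the whole inverse of \<open>A\<close>: that
  \<open>\<Phi>\<^sup>T Q N\<close> is normal is one linear equation between the entries of the first column
  of \<open>\<Phi>\<close>.  For (2), substituting the momenta and the partial derivatives of the energies
  turns Lagrange's equations into the contact equations; when the accelerations are
  eliminated from these, the friction terms cancel by that same linear equation.
\<close>

section \<open>The matrix Q on normal forces\<close>

text \<open>Up to the factor \<open>1 / ((m1 + m2) * m1)\<close> this is the lower right entry of Q;
  it is also half the denominator in the friction matrix and in the multiplier.\<close>

definition rod_D :: "real \<Rightarrow> real \<Rightarrow> real \<Rightarrow> real" where
  "rod_D m1 m2 \<theta> = m1 + m2 * (cos \<theta>)\<^sup>2"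

lemma rod_D_pos: "m1 > 0 \<Longrightarrow> m2 > 0 \<Longrightarrow> rod_D m1 m2 \<theta> > 0"
  by (simp add: rod_D_def add_pos_nonneg)

lemma double_angle_denominator:
  "2 * m1 + m2 * (1 + cos (2 * \<theta>)) = 2 * rod_D m1 m2 \<theta>"
  unfolding rod_D_def cos_double_cos by (simp add: algebra_simps)

lemma friction_entry:
  "\<kappa> * m2 * sin (2 * \<theta>) / (2 * m1 + m2 * (1 + cos (2 * \<theta>)))
   = \<kappa> * m2 * sin \<theta> * cos \<theta> / rod_D m1 m2 \<theta>"
  by (simp add: double_angle_denominator sin_double)

text \<open>The angle drops out through \<open>sin_cos_squared_add\<close>, so the kinetic energy
  matrix is invertible in every position of the rod.\<close>

lemma det_rod_A: "det (rod_A m1 m2 l \<theta>) = (m1 + m2) * m1 * m2 * l\<^sup>2"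
proof -
  have "det (rod_A m1 m2 l \<theta>)
        = (m1 + m2) * (m2 * l\<^sup>2 * (m1 + m2) - (l * m2 * cos \<theta>)\<^sup>2)
          - (m1 + m2) * (l * m2 * sin \<theta>)\<^sup>2"
    by (simp add: rod_A_def det_3 power2_eq_square algebra_simps)
  then show ?thesis
    using sin_cos_squared_add[of \<theta>] by algebra
qed

lemma rod_P_mult: "rod_P *v w = vector [w $ 1, w $ 3]"
  by (simp add: rod_P_def vec_eq_iff forall_2 matrix_vector_mult_def sum_3)

lemma transpose_rod_P_mult: "transpose rod_P *v w = vector [w $ 1, 0, w $ 2]"
  by (simp add: rod_P_def vec_eq_iff forall_3 matrix_vector_mult_def transpose_def sum_2)

lemma rod_Q_normal_force:
  assumes "m1 > 0" "m2 > 0" "l > 0"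
  shows "rod_Q m1 m2 l \<theta> *v normal_force lam
         = (lam / ((m1 + m2) * m1)) *\<^sub>R vector [- m2 * sin \<theta> * cos \<theta>, rod_D m1 m2 \<theta>]"
proof -
  define k where "k = lam / ((m1 + m2) * m1)"
  \<comment> \<open>Rows 1 and 3 of A u = (0, 0, \<open>lam\<close>) express the outer components of
    \<open>u\<close> through the middle one, and row 2 then fixes that one as
    \<open>- lam * cos \<theta> / (l * m1)\<close>. The common factor is \<open>k\<close>.\<close>
  define u :: "real^3" where
    "u = k *\<^sub>R vector [- m2 * sin \<theta> * cos \<theta>, - ((m1 + m2) * cos \<theta> / l), rod_D m1 m2 \<theta>]"
  have k: "k * ((m1 + m2) * m1) = lam" using assms by (simp add: k_def)
  have D: "rod_D m1 m2 \<theta> = m1 + m2 * (cos \<theta>)\<^sup>2" by (simp add: rod_D_def)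
  \<comment> \<open>Naming the quotient by \<open>l\<close> leaves the polynomial relation
    \<open>l * x = (m1 + m2) * cos \<theta>\<close>, so \<open>algebra\<close> meets no
    division.\<close>
  define x where "x = (m1 + m2) * cos \<theta> / l"
  have x: "l * x = (m1 + m2) * cos \<theta>" using assms by (simp add: x_def)
  have u: "u = vector [- k * m2 * sin \<theta> * cos \<theta>, - k * x, k * rod_D m1 m2 \<theta>]"
    by (simp add: u_def x_def vec_eq_iff forall_3)
  have "rod_A m1 m2 l \<theta> *v u = vector [0, 0, lam]"
  proof -
    have "(m1 + m2) * (- k * m2 * sin \<theta> * cos \<theta>) + (- l * m2 * sin \<theta>) * (- k * x) = 0"
      using x by algebra
    moreover have "(- l * m2 * sin \<theta>) * (- k * m2 * sin \<theta> * cos \<theta>) + m2 * l\<^sup>2 * (- k * x)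
        + l * m2 * cos \<theta> * (k * rod_D m1 m2 \<theta>) = 0"
      using x D sin_cos_squared_add[of \<theta>] by algebra
    moreover have "l * m2 * cos \<theta> * (- k * x) + (m1 + m2) * (k * rod_D m1 m2 \<theta>) = lam"
      using x D k by algebra
    ultimately show ?thesis
      unfolding u by (simp add: rod_A_def vec_eq_iff forall_3 matrix_vector_mult_def sum_3)
  qed
  then have Au: "rod_A m1 m2 l \<theta> *v u = transpose rod_P *v normal_force lam"
    unfolding transpose_rod_P_mult by (simp add: normal_force_def)
  have "invertible (rod_A m1 m2 l \<theta>)"
    using assms by (simp add: invertible_det_nz det_rod_A)
  \<comment> \<open>\<open>matrix_inv\<close> is a choice of two-sided inverse, so invertibility
    yields the left inverse law.\<close>
  then have "matrix_inv (rod_A m1 m2 l \<theta>) ** rod_A m1 m2 l \<theta> = mat 1"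
    unfolding matrix_inv_def invertible_def by (rule someI2_ex) blast
  then have "matrix_inv (rod_A m1 m2 l \<theta>) *v (transpose rod_P *v normal_force lam) = u"
    unfolding Au[symmetric] matrix_vector_mul_assoc by simp
  then have "rod_Q m1 m2 l \<theta> *v normal_force lam = rod_P *v u"
    by (simp only: rod_Q_def matrix_vector_mul_assoc[symmetric])
  then show ?thesis
    by (simp add: rod_P_mult u_def k_def vec_eq_iff forall_2)
qed

section \<open>Friction matrices that keep the normal direction\<close>

text \<open>As \<open>lam\<close> is nonzero, a vector is a multiple of the normal force exactly
  when its first component vanishes. That component involves only the first column of
  \<open>\<Phi>\<close>, so \<open>\<kappa>2\<close> and \<open>\<mu>2\<close> stay free.\<close>

lemma normal_preserving_iff_friction_matrix:
  assumes "m1 > 0" "m2 > 0" "l > 0" "lam > 0"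
  shows "(\<exists>\<rho>. (transpose \<Phi> ** rod_Q m1 m2 l \<theta>) *v normal_force lam = \<rho> *\<^sub>R normal_force lam)
         \<longleftrightarrow> (\<exists>\<kappa>1 \<kappa>2 \<mu>2. \<Phi> = friction_matrix m1 m2 \<theta> \<kappa>1 \<kappa>2 \<mu>2)"
    (is "?L \<longleftrightarrow> ?R")
proof -
  let ?D = "rod_D m1 m2 \<theta>"
  define k where "k = lam / ((m1 + m2) * m1)"
  have D: "?D > 0" using assms by (simp add: rod_D_pos)
  have k: "k \<noteq> 0" using assms by (auto simp: k_def)
  have w: "(transpose \<Phi> ** rod_Q m1 m2 l \<theta>) *v normal_force lam
        = k *\<^sub>R vector [\<Phi> $ 2 $ 1 * ?D - \<Phi> $ 1 $ 1 * (m2 * sin \<theta> * cos \<theta>),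
                      \<Phi> $ 2 $ 2 * ?D - \<Phi> $ 1 $ 2 * (m2 * sin \<theta> * cos \<theta>)]"
    unfolding matrix_vector_mul_assoc[symmetric] rod_Q_normal_force[OF assms(1-3)] k_def[symmetric]
    by (simp add: vec_eq_iff forall_2 matrix_vector_mult_def transpose_def sum_2 algebra_simps)
  have "?L \<longleftrightarrow> \<Phi> $ 2 $ 1 * ?D - \<Phi> $ 1 $ 1 * (m2 * sin \<theta> * cos \<theta>) = 0"
  proof
    assume ?L
    then show "\<Phi> $ 2 $ 1 * ?D - \<Phi> $ 1 $ 1 * (m2 * sin \<theta> * cos \<theta>) = 0"
      unfolding w using k by (auto simp: vec_eq_iff forall_2 normal_force_def)
  next
    assume h: "\<Phi> $ 2 $ 1 * ?D - \<Phi> $ 1 $ 1 * (m2 * sin \<theta> * cos \<theta>) = 0"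
    show ?L
      unfolding w h using assms
      \<comment> \<open>The witness is the second component of the image divided by
        \<open>lam\<close>, the second component of the normal force.\<close>
      by (intro exI[of _ "k * (\<Phi> $ 2 $ 2 * ?D - \<Phi> $ 1 $ 2 * (m2 * sin \<theta> * cos \<theta>)) / lam"])
         (simp add: vec_eq_iff forall_2 normal_force_def)
  qed
  also have "\<dots> \<longleftrightarrow> \<Phi> $ 2 $ 1 = \<Phi> $ 1 $ 1 * m2 * sin \<theta> * cos \<theta> / ?D"
    using D by (auto simp: field_simps)
  also have "\<dots> \<longleftrightarrow> ?R"
    by (auto simp: friction_matrix_def friction_entry vec_eq_iff forall_2)
  finally show ?thesis .
qed

section \<open>Lagrange's equations of the rod\<close>

lemma kinetic_energy_eq:
  "kinetic_energy m1 m2 l q v =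
     ((m1 + m2) * ((v $ 1)\<^sup>2 + (v $ 3)\<^sup>2) + m2 * l\<^sup>2 * (v $ 2)\<^sup>2) / 2
     + l * m2 * v $ 2 * (cos (q $ 2) * v $ 3 - sin (q $ 2) * v $ 1)"
  by (simp add: kinetic_energy_def rod_A_def matrix_vector_mult_def inner_vec_def sum_3
      power2_eq_square field_simps)

lemma partial_deriv_eqI:
  "((\<lambda>h. f (p + h *\<^sub>R axis i 1)) has_real_derivative D) (at 0) \<Longrightarrow> partial_deriv f i p = D"
  by (simp add: partial_deriv_def DERIV_imp_deriv)

text \<open>The kinetic energy is half the quadratic form of a symmetric matrix, so its velocity
  gradient, the generalized momentum, is that matrix applied to \<open>v\<close>.\<close>

lemma partial_deriv_kinetic_energy_velocity:
  "partial_deriv (kinetic_energy m1 m2 l q) i v = (rod_A m1 m2 l (q $ 2) *v v) $ i"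
  (is "?L i = ?R i")
proof -
  have "?L 1 = ?R 1" "?L 2 = ?R 2" "?L 3 = ?R 3"
    by (rule partial_deriv_eqI;
        auto intro!: derivative_eq_intros
          simp: kinetic_energy_eq rod_A_def matrix_vector_mult_def sum_3 axis_def
            power2_eq_square field_simps)+
  then show ?thesis using exhaust_3[of i] by auto
qed

text \<open>The position enters the kinetic energy only through the angle.\<close>

lemma partial_deriv_kinetic_energy_position:
  "partial_deriv (\<lambda>p. kinetic_energy m1 m2 l p v) i q =
     (if i = 2 then - l * m2 * v $ 2 * (sin (q $ 2) * v $ 3 + cos (q $ 2) * v $ 1) else 0)"
  (is "?L i = ?R i")
proof -
  have "?L 1 = ?R 1" "?L 2 = ?R 2" "?L 3 = ?R 3"
    by (rule partial_deriv_eqI;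
        auto intro!: derivative_eq_intros
          simp: kinetic_energy_eq axis_def power2_eq_square field_simps)+
  then show ?thesis using exhaust_3[of i] by auto
qed

lemma partial_deriv_potential_energy:
  "partial_deriv (potential_energy m1 m2 l g) i q =
     vector [0, m2 * g * l * cos (q $ 2), (m1 + m2) * g] $ i"
  (is "?L i = ?R i")
proof -
  have "?L 1 = ?R 1" "?L 2 = ?R 2" "?L 3 = ?R 3"
    by (rule partial_deriv_eqI;
        auto intro!: derivative_eq_intros
          simp: potential_energy_def axis_def field_simps)+
  then show ?thesis using exhaust_3[of i] by auto
qed

lemma has_real_derivative_vec_nth:
  "(f has_vector_derivative f') (at t) \<Longrightarrow> ((\<lambda>\<tau>. f \<tau> $ i) has_real_derivative f' $ i) (at t)"
  unfolding has_real_derivative_iff_has_vector_derivative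
  by (rule bounded_linear.has_vector_derivative[OF bounded_linear_vec_nth])

text \<open>The velocity terms of the second component equal the derivative of the kinetic energy in
  the angle, so they cancel in the second Lagrange equation.\<close>

lemma momentum_has_derivative:
  assumes "(q has_vector_derivative v t) (at t)" "(v has_vector_derivative a) (at t)"
  shows "((\<lambda>\<tau>. (rod_A m1 m2 l (q \<tau> $ 2) *v v \<tau>) $ i) has_real_derivative
          vector
            [(m1 + m2) * a $ 1 - l * m2 * (sin (q t $ 2) * a $ 2 + cos (q t $ 2) * (v t $ 2)\<^sup>2),
             m2 * l\<^sup>2 * a $ 2 + l * m2 * (cos (q t $ 2) * a $ 3 - sin (q t $ 2) * a $ 1)
               - l * m2 * v t $ 2 * (sin (q t $ 2) * v t $ 3 + cos (q t $ 2) * v t $ 1),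
             (m1 + m2) * a $ 3 + l * m2 * (cos (q t $ 2) * a $ 2 - sin (q t $ 2) * (v t $ 2)\<^sup>2)]
            $ i) (at t)"
  (is "?P i")
proof -
  note d = has_real_derivative_vec_nth[OF assms(1)] has_real_derivative_vec_nth[OF assms(2)]
  have "?P 1" "?P 2" "?P 3"
    by (auto intro!: derivative_eq_intros d
          simp: rod_A_def matrix_vector_mult_def sum_3 power2_eq_square field_simps)
  then show ?thesis using exhaust_3[of i] by auto
qed

lemma lagrange_equations_iff:
  assumes "(q has_vector_derivative v t) (at t)" "(v has_vector_derivative a) (at t)"
  shows "lagrange_equations m1 m2 l g q v R t \<longleftrightarrow>
    (m1 + m2) * a $ 1 - l * m2 * (sin (q t $ 2) * a $ 2 + cos (q t $ 2) * (v t $ 2)\<^sup>2) = R $ 1 \<and>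
    m2 * l\<^sup>2 * a $ 2 + l * m2 * (cos (q t $ 2) * a $ 3 - sin (q t $ 2) * a $ 1)
      = - m2 * g * l * cos (q t $ 2) + R $ 2 \<and>
    (m1 + m2) * a $ 3 + l * m2 * (cos (q t $ 2) * a $ 2 - sin (q t $ 2) * (v t $ 2)\<^sup>2)
      = - (m1 + m2) * g + R $ 3"
proof -
  \<comment> \<open>Derivatives are unique, so each Lagrange equation becomes an equality between
    two values of the same derivative.\<close>
  have DERIV_iff: "(f has_real_derivative X) (at t) \<longleftrightarrow> X = D"
    if "(f has_real_derivative D) (at t)" for f X D
    using that DERIV_unique by blast
  show ?thesis
    unfolding lagrange_equations_def partial_deriv_kinetic_energy_velocity
      DERIV_iff[OF momentum_has_derivative[OF assms]]
      partial_deriv_kinetic_energy_position partial_deriv_potential_energy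
    by (auto simp: forall_3 algebra_simps)
qed

section \<open>Equations of motion under contact\<close>

text \<open>A direction \<open>(s, 0)\<close> picks out the first column of the friction matrix, so
  only \<open>\<kappa>1\<close> and the entry below it act; the force has no component along the
  angle.\<close>

lemma contact_lagrange_iff:
  assumes "(q has_vector_derivative v t) (at t)" "(v has_vector_derivative a) (at t)" "a $ 3 = 0"
  shows "lagrange_equations m1 m2 l g q v
           (transpose rod_P *v normal_force lam
            + friction_force lam (friction_matrix m1 m2 (q t $ 2) \<kappa>1 \<kappa>2 \<mu>2) (vector [s, 0])) t
         \<longleftrightarrow> contact_equations m1 m2 l g \<kappa>1 s (q t $ 2) (v t $ 2) (a $ 1) (a $ 2) lam"
proof -
  define E where "E = \<kappa>1 * m2 * sin (2 * (q t $ 2)) / (2 * m1 + m2 * (1 + cos (2 * (q t $ 2))))"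
  have F: "transpose rod_P *v normal_force lam
            + friction_force lam (friction_matrix m1 m2 (q t $ 2) \<kappa>1 \<kappa>2 \<mu>2) (vector [s, 0])
          = vector [- lam * \<kappa>1 * s, 0, lam - lam * s * E]"
    unfolding friction_force_def transpose_rod_P_mult friction_matrix_def E_def[symmetric]
    by (simp add: vec_eq_iff forall_3 normal_force_def matrix_vector_mult_def sum_2)
  show ?thesis
    unfolding F lagrange_equations_iff[OF assms(1,2)] contact_equations_def E_def[symmetric]
    using assms(3) by (auto simp: algebra_simps power2_eq_square)
qed

lemma frictionless_lagrange_iff:
  assumes "(q has_vector_derivative v t) (at t)" "(v has_vector_derivative a) (at t)" "a $ 3 = 0"
  shows "lagrange_equations m1 m2 l g q v (transpose rod_P *v normal_force lam) t
         \<longleftrightarrow> frictionless_contact_equations m1 m2 l g (q t $ 2) (v t $ 2) (a $ 1) (a $ 2) lam"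
  unfolding lagrange_equations_iff[OF assms(1,2)] frictionless_contact_equations_def
    transpose_rod_P_mult normal_force_def
  using assms(3) by (auto simp: algebra_simps power2_eq_square)

text \<open>Turns the vector direction of sliding into the set-valued sign: off zero,
  \<open>u / \<bar>u\<bar>\<close> is the sign of \<open>u\<close>; at rest both sides run over
  \<open>{-1..1}\<close>.\<close>

lemma sliding_directions_horizontal:
  "sliding_directions (vector [u, 0]) = (\<lambda>s. vector [s, 0]) ` set_sign u"
proof (cases "u = 0")
  case True
  then have "vector [u, 0] = (0 :: real^2)" by (simp add: vec_eq_iff forall_2)
  then show ?thesis using True by (auto simp: sliding_directions_def)
next
  case False
  have n: "norm (vector [u, 0] :: real^2) = \<bar>u\<bar>"
    by (simp add: norm_vec_def L2_set_def sum_2)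
  have "vector [u, 0] \<noteq> (0 :: real^2)"
    using False by (simp add: vec_eq_iff forall_2)
  moreover have "vector [u, 0] /\<^sub>R \<bar>u\<bar> = (vector [u / \<bar>u\<bar>, 0] :: real^2)"
    by (simp add: vec_eq_iff forall_2 divide_inverse)
  ultimately show ?thesis
    using False by (auto simp: sliding_directions_def n set_sign_def)
qed

section \<open>The Lagrange multiplier with and without friction\<close>

lemma contact_multiplier:
  assumes "m1 > 0" "m2 > 0" "l > 0"
    and "contact_equations m1 m2 l g \<kappa>1 s \<theta> \<omega> ax \<epsilon> lam"
  shows "lam = 2 * m1 * ((m1 + m2) * g - l * m2 * \<omega>\<^sup>2 * sin \<theta>)
                / (2 * m1 + m2 * (1 + cos (2 * \<theta>)))"
proof -
  define D S C where "D = rod_D m1 m2 \<theta>" and "S = sin \<theta>" and "C = cos \<theta>"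
  have D: "D > 0" using assms by (simp add: D_def rod_D_pos)
  define K where "K = \<kappa>1 * m2 * S * C / D"
  have KD: "K * D = \<kappa>1 * m2 * S * C" using D by (simp add: K_def)
  have DC: "D = m1 + m2 * C\<^sup>2" by (simp add: D_def C_def rod_D_def)
  have SC: "S\<^sup>2 + C\<^sup>2 = 1" by (simp add: S_def C_def)
  have e1: "(m1 + m2) * ax - l * m2 * \<epsilon> * S = l * m2 * \<omega>\<^sup>2 * C - lam * \<kappa>1 * s"
    and e2: "l * m2 * (ax * S - l * \<epsilon>) = l * m2 * g * C"
    and e3: "l * m2 * \<epsilon> * C = - (m1 + m2) * g + l * m2 * \<omega>\<^sup>2 * S + lam - lam * s * K"
    using assms(4) unfolding contact_equations_def friction_entry D_def S_def C_def K_def by auto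
  have e2': "l * \<epsilon> = ax * S - g * C" using e2 assms by simp
  have "D * ax = l * m2 * \<omega>\<^sup>2 * C - m2 * g * S * C - lam * \<kappa>1 * s"
    using e1 e2' DC SC by algebra
  moreover have "m2 * C * (ax * S - g * C)
      = - (m1 + m2) * g + l * m2 * \<omega>\<^sup>2 * S + lam - lam * s * K"
    using e2' e3 by algebra
  \<comment> \<open>Multiply the last equation by \<open>D\<close> and insert \<open>D * ax\<close>:
    friction then contributes \<open>- lam * s * \<kappa>1 * m2 * S * C\<close> on the left through
    \<open>ax\<close> and the same on the right through \<open>KD\<close>.\<close>
  ultimately have "lam * D = m1 * ((m1 + m2) * g - l * m2 * \<omega>\<^sup>2 * S)"
    using KD DC SC by algebra
  then show ?thesis
    using D unfolding double_angle_denominator D_def[symmetric] S_def[symmetric]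
    by (simp add: field_simps)
qed

text \<open>Makes \<open>contact_multiplier\<close> applicable to the frictionless system
  too.\<close>

lemma frictionless_contact_equations_eq:
  "frictionless_contact_equations m1 m2 l g = contact_equations m1 m2 l g 0 0"
  by (intro ext) (simp add: frictionless_contact_equations_def contact_equations_def)

text \<open>The first two equations determine the accelerations for any \<open>lam\<close>; the
  third then holds because of the value assumed for \<open>lam\<close>.\<close>

lemma frictionless_contact_solvable:
  assumes "m1 > 0" "m2 > 0" "l > 0"
    and "lam = 2 * m1 * ((m1 + m2) * g - l * m2 * \<omega>\<^sup>2 * sin \<theta>)
                / (2 * m1 + m2 * (1 + cos (2 * \<theta>)))"
  shows "\<exists>ax \<epsilon>. frictionless_contact_equations m1 m2 l g \<theta> \<omega> ax \<epsilon> lam"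
proof -
  define D S C where "D = rod_D m1 m2 \<theta>" and "S = sin \<theta>" and "C = cos \<theta>"
  have D: "D > 0" using assms by (simp add: D_def rod_D_pos)
  have DC: "D = m1 + m2 * C\<^sup>2" by (simp add: D_def C_def rod_D_def)
  have SC: "S\<^sup>2 + C\<^sup>2 = 1" by (simp add: S_def C_def)
  \<comment> \<open>Solution of the first two equations: the second gives \<open>\<epsilon>\<close>
    in terms of \<open>ax\<close>, and substitution into the first leaves \<open>D\<close> as the
    coefficient of \<open>ax\<close>.\<close>
  define ax where "ax = (l * m2 * \<omega>\<^sup>2 * C - m2 * g * S * C) / D"
  define \<epsilon> where "\<epsilon> = (ax * S - g * C) / l"
  have lam: "lam * D = m1 * ((m1 + m2) * g - l * m2 * \<omega>\<^sup>2 * S)"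
    using D unfolding assms(4) double_angle_denominator D_def[symmetric] S_def[symmetric]
    by (simp add: field_simps)
  have ax: "D * ax = l * m2 * \<omega>\<^sup>2 * C - m2 * g * S * C" using D by (simp add: ax_def)
  have \<epsilon>: "l * \<epsilon> = ax * S - g * C" using assms by (simp add: \<epsilon>_def)
  have "(m1 + m2) * ax - l * m2 * \<epsilon> * S = l * m2 * \<omega>\<^sup>2 * C"
    using ax \<epsilon> DC SC by algebra
  moreover have "l * m2 * (ax * S - l * \<epsilon>) = l * m2 * g * C"
    using \<epsilon> by algebra
  moreover have "l * m2 * \<epsilon> * C = - (m1 + m2) * g + l * m2 * \<omega>\<^sup>2 * S + lam"
  proof -
    \<comment> \<open>Scaling by the positive \<open>D\<close> clears the denominators of
      \<open>ax\<close> and \<open>lam\<close>.\<close>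
    have "D * (l * m2 * \<epsilon> * C) = D * (- (m1 + m2) * g + l * m2 * \<omega>\<^sup>2 * S + lam)"
      using ax \<epsilon> DC SC lam by algebra
    then show ?thesis using D by simp
  qed
  ultimately show ?thesis
    unfolding frictionless_contact_equations_def S_def C_def by blast
qed

text \<open>The second conjunct grounds the displayed equations of motion in Lagrange's equations;
  the fourth shows that the value in the third is exactly the frictionless multiplier.\<close>

theorem mainTheorem4:
  fixes m1 m2 l g :: real
  assumes "m1 > 0" and "m2 > 0" and "l > 0" and "g > 0"
  shows
    "(\<forall>\<theta> lam (\<Phi> :: real^2^2). lam > 0 \<longrightarrow>
        (nonneg_definite \<Phi> \<and>
         (\<exists>\<rho>. (transpose \<Phi> ** rod_Q m1 m2 l \<theta>) *v normal_force lam = \<rho> *\<^sub>R normal_force lam)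
         \<longleftrightarrow>
         (\<exists>\<kappa>1 \<kappa>2 \<mu>2. \<Phi> = friction_matrix m1 m2 \<theta> \<kappa>1 \<kappa>2 \<mu>2 \<and> nonneg_definite \<Phi>)))
     \<and>
     (\<forall>(q :: real \<Rightarrow> real^3) v a I t lam.
        open I \<and> t \<in> I \<and>
        (\<forall>\<tau>\<in>I. (q has_vector_derivative v \<tau>) (at \<tau>)) \<and>
        (\<forall>\<tau>\<in>I. (v has_vector_derivative a \<tau>) (at \<tau>)) \<and>
        q t $ 3 = 0 \<and> v t $ 3 = 0 \<and> a t $ 3 = 0 \<longrightarrow>
        (\<forall>\<kappa>1 \<kappa>2 \<mu>2. nonneg_definite (friction_matrix m1 m2 (q t $ 2) \<kappa>1 \<kappa>2 \<mu>2) \<longrightarrow>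
           (\<exists>d \<in> sliding_directions (rod_P *v v t).
              lagrange_equations m1 m2 l g q v
                (transpose rod_P *v normal_force lam
                 + friction_force lam (friction_matrix m1 m2 (q t $ 2) \<kappa>1 \<kappa>2 \<mu>2) d) t)
           \<longleftrightarrow>
           (\<exists>s \<in> set_sign (v t $ 1).
              contact_equations m1 m2 l g \<kappa>1 s (q t $ 2) (v t $ 2) (a t $ 1) (a t $ 2) lam)) \<and>
        (lagrange_equations m1 m2 l g q v (transpose rod_P *v normal_force lam) t
           \<longleftrightarrow>
         frictionless_contact_equations m1 m2 l g (q t $ 2) (v t $ 2) (a t $ 1) (a t $ 2) lam))
     \<and>
     (\<forall>\<kappa>1 \<kappa>2 \<mu>2 \<theta> \<omega> vx ax \<epsilon> lam s.
        nonneg_definite (friction_matrix m1 m2 \<theta> \<kappa>1 \<kappa>2 \<mu>2) \<and> s \<in> set_sign vx \<and>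
        contact_equations m1 m2 l g \<kappa>1 s \<theta> \<omega> ax \<epsilon> lam \<longrightarrow>
        lam = 2 * m1 * ((m1 + m2) * g - l * m2 * \<omega>^2 * sin \<theta>)
                / (2 * m1 + m2 * (1 + cos (2 * \<theta>))))
     \<and>
     (\<forall>\<theta> \<omega> lam0.
        (\<exists>ax \<epsilon>. frictionless_contact_equations m1 m2 l g \<theta> \<omega> ax \<epsilon> lam0) \<longleftrightarrow>
        lam0 = 2 * m1 * ((m1 + m2) * g - l * m2 * \<omega>^2 * sin \<theta>)
                 / (2 * m1 + m2 * (1 + cos (2 * \<theta>))))"
  using assms(1-3)
  apply (intro conjI)
  subgoal
    using normal_preserving_iff_friction_matrix by blast
  subgoal
  proof (intro allI impI, elim conjE, intro conjI allI impI)
    fix q v a :: "real \<Rightarrow> real^3" and I t lam \<kappa>1 \<kappa>2 \<mu>2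
    assume t: "t \<in> I" and dq: "\<forall>\<tau>\<in>I. (q has_vector_derivative v \<tau>) (at \<tau>)"
      and dv: "\<forall>\<tau>\<in>I. (v has_vector_derivative a \<tau>) (at \<tau>)"
      and v3: "v t $ 3 = 0" and a3: "a t $ 3 = 0"
    have d: "(q has_vector_derivative v t) (at t)" "(v has_vector_derivative a t) (at t)"
      using dq dv t by auto
    show "(\<exists>d \<in> sliding_directions (rod_P *v v t).
              lagrange_equations m1 m2 l g q v
                (transpose rod_P *v normal_force lam
                 + friction_force lam (friction_matrix m1 m2 (q t $ 2) \<kappa>1 \<kappa>2 \<mu>2) d) t)
           \<longleftrightarrow>
           (\<exists>s \<in> set_sign (v t $ 1).
              contact_equations m1 m2 l g \<kappa>1 s (q t $ 2) (v t $ 2) (a t $ 1) (a t $ 2) lam)"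
      \<comment> \<open>Since \<open>v t $ 3 = 0\<close>, the contact velocity is horizontal, and
        choosing \<open>d\<close> amounts to choosing \<open>s\<close>.\<close>
      by (simp only: rod_P_mult v3 sliding_directions_horizontal bex_simps contact_lagrange_iff[OF d a3])
    show "lagrange_equations m1 m2 l g q v (transpose rod_P *v normal_force lam) t
           \<longleftrightarrow>
         frictionless_contact_equations m1 m2 l g (q t $ 2) (v t $ 2) (a t $ 1) (a t $ 2) lam"
      by (rule frictionless_lagrange_iff[OF d a3])
  qed
  subgoal
    using contact_multiplier by blast
  subgoal
    using contact_multiplier frictionless_contact_solvable
    by (metis frictionless_contact_equations_eq)
  done

end
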